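(* Let $1\le m\le n$, let $\Sigma\subset\mathbb{R}^n$ be an $m$-dimensional flat surface, let $\mathbf{x}_0\in\Sigma$, and let $A=[\vec v_1,\dots,\vec v_m]$ be an $n\times m$ matrix whose columns form a basis of the direction space of the affine hull of $\Sigma$, so that $\Sigma$ is the image of a reference domain $\Sigma_s\subset\mathbb{R}^m$ under the affine map $\mathbf{s}\mapsto \mathbf{x}=\mathbf{x}_0+A\mathbf{s}$. Let $\phi$ be a smooth function on $\mathbb{R}^n$ and let $\tilde\phi(\mathbf{s}):=\phi(\mathbf{x}_0+A\mathbf{s})$, $\mathbf{s}\in\Sigma_s$. Then, for any integer $\ell\ge 0$, the following identity holds for $\mathbf{s}\in\Sigma_s$ with $\mathbf{x}=\mathbf{x}_0+A\mathbf{s}$: $$ \frac{\tilde\phi(\mathbf{s})}{(m-1)!} = \sum_{k=0}^\ell \frac{(-1)^k}{(k+m)!} \nabla_s \cdot \bigl(\mathbf{s}\, \nabla_x^k \phi : (\mathbf{x} - \mathbf{x}_0)^k\bigr) + \frac{(-1)^{\ell+1}}{(\ell+m)!} \nabla_x^{\ell+1} \phi : (\mathbf{x} - \mathbf{x}_0)^{\ell+1}. $$ Moreover, if $\phi \in C^\infty(\mathbb{R}^n)$, then $$ \frac{\tilde\phi(\mathbf{s})}{(m-1)!} = \sum_{k=0}^\infty \frac{(-1)^k}{(k+m)!} \nabla_s \cdot \bigl(\mathbf{s}\, \nabla_x^k \phi : (\mathbf{x} - \mathbf{x}_0)^k\bigr), $$ provided that the series converges.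
   Context: For an integer $k\ge 0$, $$\nabla_x^k \phi : (\mathbf{x}-\mathbf{x}_0)^k := \sum_{1\le j_1,\dots,j_k\le n} (\mathbf{x}-\mathbf{x}_0)_{j_1}\cdots (\mathbf{x}-\mathbf{x}_0)_{j_k}\,\partial^k_{j_1,\dots,j_k} \phi(\mathbf{x}),$$ where the derivatives of $\phi$ are taken in $\mathbb{R}^n$ and evaluated at $\mathbf{x}$; for $k=0$ it equals $\phi(\mathbf{x})$. Via $\mathbf{x}=\mathbf{x}_0+A\mathbf{s}$ it is regarded as a scalar function of $\mathbf{s}$. The operator $\nabla_s\cdot$ is the divergence with respect to $\mathbf{s}\in\mathbb{R}^m$, i.e. $\nabla_s\cdot(\mathbf{s}\,g)=\sum_{j=1}^m\partial_{s_j}(s_j\,g)$ for a scalar function $g$ of $\mathbf{s}$.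
   Formalization: "Provided that the series converges" is taken to mean that the series converges at every point of the segment from 0 to s; convergence at s alone does not suffice (e.g. m=n=1, x_0=0, φ smooth with φ(x)=1/x near x=1: the series at s=1 sums to 0, not 1). *)

theory Defs
  imports "HOL-Analysis.Analysis"
begin

definition partial_deriv :: "'n \<Rightarrow> (real ^ 'n \<Rightarrow> real) \<Rightarrow> real ^ 'n \<Rightarrow> real" where
  "partial_deriv j f x = deriv (\<lambda>t. f (x + t *\<^sub>R axis j 1)) 0"

text \<open>A multi-index \<open>(j\<^sub>1, \<dots>, j\<^sub>k)\<close> is a list of coordinate indices of length \<open>k\<close>.\<close>

fun iter_partial_deriv :: "'n list \<Rightarrow> (real ^ 'n \<Rightarrow> real) \<Rightarrow> real ^ 'n \<Rightarrow> real" where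
  "iter_partial_deriv [] f = f"
| "iter_partial_deriv (j # js) f = partial_deriv j (iter_partial_deriv js f)"

text \<open>\<open>C\<^sup>k\<close> on the whole space: all iterated partial derivatives of order at most \<open>k\<close> exist
  and are continuous. Existence has to be stated separately because \<^const>\<open>deriv\<close> is total.\<close>

definition C_k :: "nat \<Rightarrow> (real ^ 'n \<Rightarrow> real) \<Rightarrow> bool" where
  "C_k k f \<longleftrightarrow>
     (\<forall>js j x. length js < k \<longrightarrow>
        (\<lambda>t. iter_partial_deriv js f (x + t *\<^sub>R axis j 1)) field_differentiable at 0) \<and>
     (\<forall>js. length js \<le> k \<longrightarrow> continuous_on UNIV (iter_partial_deriv js f))"

definition C_infinity :: "(real ^ 'n \<Rightarrow> real) \<Rightarrow> bool" where
  "C_infinity f \<longleftrightarrow> (\<forall>k. C_k k f)"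

definition divergence :: "(real ^ 'm \<Rightarrow> real ^ 'm) \<Rightarrow> real ^ 'm \<Rightarrow> real" where
  "divergence F s = (\<Sum>j\<in>UNIV. partial_deriv j (\<lambda>u. F u $ j) s)"

text \<open>The contraction \<open>\<nabla>\<^sub>x\<^sup>k \<phi> : v\<^sup>k\<close>, with the derivatives of \<open>\<phi>\<close> evaluated at \<open>x\<close>.\<close>

definition nabla_contract ::
    "nat \<Rightarrow> (real ^ 'n \<Rightarrow> real) \<Rightarrow> real ^ 'n \<Rightarrow> real ^ 'n \<Rightarrow> real" where
  "nabla_contract k \<phi> x v =
     (\<Sum>js | length js = k. (\<Prod>i<k. v $ (js ! i)) * iter_partial_deriv js \<phi> x)"

definition direction_space :: "(real ^ 'n) set \<Rightarrow> (real ^ 'n) set" where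
  "direction_space S = {y - x | x y. x \<in> affine hull S \<and> y \<in> affine hull S}"

text \<open>Injectivity of \<open>j \<mapsto> column j A\<close> is needed since \<^term>\<open>columns A\<close> is a set,
  which does not see repeated columns.\<close>

definition columns_form_basis :: "real ^ 'm ^ 'n \<Rightarrow> (real ^ 'n) set \<Rightarrow> bool" where
  "columns_form_basis A V \<longleftrightarrow>
     inj (\<lambda>j. column j A) \<and> independent (columns A) \<and> span (columns A) = V"

text \<open>The \<open>k\<close>-th term of the expansion, with \<open>m = CARD('m)\<close> and \<open>x = x\<^sub>0 + A s\<close>.\<close>

definition expansion_term ::
    "real ^ 'm ^ 'n \<Rightarrow> real ^ 'n \<Rightarrow> (real ^ 'n \<Rightarrow> real) \<Rightarrow> real ^ 'm \<Rightarrow> nat \<Rightarrow> real" where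
  "expansion_term A x0 \<phi> s k =
     (-1) ^ k / fact (k + CARD('m)) *
       divergence (\<lambda>u. nabla_contract k \<phi> (x0 + A *v u) ((x0 + A *v u) - x0) *\<^sub>R u) s"

end

theory Submission
  imports Defs
begin

text \<open>
Let \<open>m = CARD('m)\<close> and let \<open>g\<^sub>k(s)\<close> be the contraction of order \<open>k\<close> at \<open>x\<^sub>0 + A s\<close> with the vector \<open>A s\<close>.
Since the contraction is homogeneous of degree \<open>k\<close> in its vector argument, the divergence of \<open>s g\<^sub>k(s)\<close> is
\<open>(k + m) g\<^sub>k(s) + g\<^bsub>k+1\<^esub>(s)\<close> (lemma \<open>divergence_nabla_contract\<close>). With
\<open>a\<^sub>k(s) = (-1)\<^sup>k g\<^sub>k(s) / (k + m - 1)!\<close> the \<open>k\<close>-th term of the expansion is therefore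
\<open>a\<^sub>k(s) - a\<^bsub>k+1\<^esub>(s)\<close>, and the sum telescopes to \<open>a\<^sub>0(s)\<close>, the left-hand side, minus the stated remainder.

For the infinite series it must be shown that \<open>a\<^sub>k(s)\<close>, which converges together with the series, tends
to 0. Along the ray through \<open>s\<close> put \<open>h(t) = \<phi> (x\<^sub>0 + t A s)\<close>, so that
\<open>a\<^sub>k(t s) = (-t)\<^sup>k h\<^bsup>(k)\<^esup>(t) / (k + m - 1)!\<close>; this converges for every \<open>t\<close> in \<open>[0, 1]\<close>,
because the series converges on the whole segment from 0 to \<open>s\<close>. Boundedness in
\<open>k\<close> says that the Taylor series of \<open>h\<close> about each \<open>t\<close> has radius of convergence at least \<open>t\<close>. By the
theorem of Pringsheim and Boas (\<open>Pringsheim_Boas\<close>, a Baire category argument) \<open>h\<close> is analytic on \<open>(0, 1]\<close>,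
and by the identity theorem it is the sum there of its Taylor series about 1, that is, of a power series in \<open>1 - t\<close>
with coefficients \<open>(-1)\<^sup>k h\<^bsup>(k)\<^esup>(1) / k!\<close>. If \<open>a\<^sub>k(s)\<close> had a nonzero limit, these coefficients would
eventually be of one sign and bounded away from 0, and \<open>h(t)\<close> would be unbounded as \<open>t\<close> tends to 0,
contrary to continuity at 0 (\<open>scaled_derivatives_limit_zero\<close>).
\<close>

section \<open>The divergence of the contracted derivatives\<close>

text \<open>Move from \<open>x\<close> to \<open>x + h\<close> one coordinate at a time. By the mean value theorem each step changes
\<open>f\<close> by \<open>h\<^sub>i\<close> times \<open>p i\<close> at a point no farther than \<open>norm h\<close> from \<open>x\<close>, and continuity of \<open>p i\<close>
lets this be replaced by \<open>p i x\<close>. The induction is over the set of coordinates already moved.\<close>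

lemma has_derivative_continuous_partials:
  fixes f :: "real ^ 'n \<Rightarrow> real" and p :: "'n \<Rightarrow> real ^ 'n \<Rightarrow> real"
  assumes partial: "\<And>j x. ((\<lambda>t. f (x + t *\<^sub>R axis j 1)) has_real_derivative p j x) (at 0)"
    and cont: "\<And>j. continuous_on UNIV (p j)"
  shows "(f has_derivative (\<lambda>h. \<Sum>j\<in>UNIV. h $ j * p j x)) (at x)"
proof -
  define part :: "'n set \<Rightarrow> real ^ 'n \<Rightarrow> real ^ 'n"
    where "part J h = (\<chi> j. if j \<in> J then h $ j else 0)" for J h
  have line: "((\<lambda>t. f (y + t *\<^sub>R axis j 1)) has_real_derivative p j (y + t *\<^sub>R axis j 1)) (at t)"
    for y j t
    using partial[where j = j and x = "y + t *\<^sub>R axis j 1"] 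
      DERIV_shift[of "\<lambda>t. f (y + t *\<^sub>R axis j 1)" "p j (y + t *\<^sub>R axis j 1)" 0 t]
    by (simp add: algebra_simps)
  have approx: "\<exists>d>0. \<forall>h. norm h < d \<longrightarrow>
      \<bar>f (x + part J h) - f x - (\<Sum>j\<in>J. h $ j * p j x)\<bar> \<le> e * norm h"
    if "finite J" "e > 0" for J and e :: real
    using that
  proof (induction J arbitrary: e rule: finite_induct)
    case empty
    have "part {} h = 0" for h by (simp add: part_def vec_eq_iff)
    then show ?case using empty by (auto intro!: exI[of _ 1])
  next
    case (insert i J)
    obtain d1 where d1: "d1 > 0" "\<And>h. norm h < d1 \<Longrightarrow>
        \<bar>f (x + part J h) - f x - (\<Sum>j\<in>J. h $ j * p j x)\<bar> \<le> e / 2 * norm h"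
      using insert.IH[of "e / 2"] \<open>e > 0\<close> by auto
    obtain d2 where d2: "d2 > 0" "\<And>y. dist y x < d2 \<Longrightarrow> dist (p i y) (p i x) < e / 2"
      using cont[of i] \<open>e > 0\<close> unfolding continuous_on_iff by (metis UNIV_I half_gt_zero)
    have "\<bar>f (x + part (insert i J) h) - f x - (\<Sum>j\<in>insert i J. h $ j * p j x)\<bar> \<le> e * norm h"
      if h: "norm h < min d1 d2" for h
    proof -
      define y where "y = x + part J h"
      have ins: "x + part (insert i J) h = y + (h $ i) *\<^sub>R axis i 1"
        using insert(2) by (auto simp: y_def part_def vec_eq_iff axis_def)
      have "\<exists>c. f (y + (h $ i) *\<^sub>R axis i 1) - f y = h $ i * p i (y + c *\<^sub>R axis i 1) \<and> \<bar>c\<bar> \<le> \<bar>h $ i\<bar>"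
      proof (cases "h $ i" "0::real" rule: linorder_cases)
        case equal
        then show ?thesis by (intro exI[of _ 0]) simp
      next
        case less
        from MVT2[OF this line[of y i]] obtain c where "h $ i < c" "c < 0"
          "f (y + 0 *\<^sub>R axis i 1) - f (y + (h $ i) *\<^sub>R axis i 1) = (0 - h $ i) * p i (y + c *\<^sub>R axis i 1)"
          by blast
        then show ?thesis by (intro exI[of _ c]) (auto simp: algebra_simps)
      next
        case greater
        from MVT2[OF this line[of y i]] obtain c where "c < h $ i" "0 < c"
          "f (y + (h $ i) *\<^sub>R axis i 1) - f (y + 0 *\<^sub>R axis i 1) = (h $ i - 0) * p i (y + c *\<^sub>R axis i 1)"
          by blast
        then show ?thesis by (intro exI[of _ c]) (auto simp: algebra_simps)
      qed
      then obtain c where c: "\<bar>c\<bar> \<le> \<bar>h $ i\<bar>"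
        "f (y + (h $ i) *\<^sub>R axis i 1) - f y = h $ i * p i (y + c *\<^sub>R axis i 1)" by blast
      have "norm (y + c *\<^sub>R axis i 1 - x) \<le> norm h"
        by (rule norm_le_componentwise_cart)
           (use c insert(2) in \<open>auto simp: y_def part_def axis_def\<close>)
      then have "dist (p i (y + c *\<^sub>R axis i 1)) (p i x) < e / 2"
        using h by (intro d2) (auto simp: dist_norm)
      then have incr: "\<bar>h $ i * (p i (y + c *\<^sub>R axis i 1) - p i x)\<bar> \<le> norm h * (e / 2)"
        unfolding abs_mult by (intro mult_mono) (auto simp: component_le_norm_cart dist_real_def)
      have old: "\<bar>f y - f x - (\<Sum>j\<in>J. h $ j * p j x)\<bar> \<le> e / 2 * norm h"
        using d1(2)[of h] h by (simp add: y_def)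
      have split: "f (x + part (insert i J) h) - f x - (\<Sum>j\<in>insert i J. h $ j * p j x)
          = (f y - f x - (\<Sum>j\<in>J. h $ j * p j x)) + h $ i * (p i (y + c *\<^sub>R axis i 1) - p i x)"
        using insert(1,2) c(2) by (simp add: ins algebra_simps)
      show ?thesis
        unfolding split using order_trans[OF abs_triangle_ineq add_mono[OF old incr]] by simp
    qed
    then show ?case using d1(1) d2(1) by (intro exI[of _ "min d1 d2"]) auto
  qed
  have "part UNIV h = h" for h by (simp add: part_def vec_eq_iff)
  then have *: "\<exists>d>0. \<forall>h. norm h < d \<longrightarrow>
      \<bar>f (x + h) - f x - (\<Sum>j\<in>UNIV. h $ j * p j x)\<bar> \<le> e * norm h" if "e > 0" for e
    using approx[OF finite_class.finite_UNIV that] by simp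
  have lin: "bounded_linear (\<lambda>h. \<Sum>j\<in>UNIV. h $ j * p j x)"
    by (intro bounded_linear_sum bounded_linear_mult_const bounded_linear_vec_nth)
  show ?thesis
    unfolding has_derivative_at_alt
  proof (intro conjI allI impI lin)
    fix e :: real assume "e > 0"
    from *[OF this] obtain d where "d > 0" and d: "\<And>h. norm h < d \<Longrightarrow>
      \<bar>f (x + h) - f x - (\<Sum>j\<in>UNIV. h $ j * p j x)\<bar> \<le> e * norm h" by blast
    then show "\<exists>d>0. \<forall>y. norm (y - x) < d \<longrightarrow>
      norm (f y - f x - (\<Sum>j\<in>UNIV. (y - x) $ j * p j x)) \<le> e * norm (y - x)"
      by (intro exI[of _ d]) (auto dest: d[of "_ - x"])
  qed
qed

lemma has_derivative_iter_partial_deriv: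
  fixes \<phi> :: "real ^ 'n \<Rightarrow> real"
  assumes "C_k (Suc k) \<phi>" "length js \<le> k"
  shows "(iter_partial_deriv js \<phi> has_derivative
           (\<lambda>h. \<Sum>j\<in>UNIV. h $ j * iter_partial_deriv (j # js) \<phi> x)) (at x)"
proof (rule has_derivative_continuous_partials)
  show "((\<lambda>t. iter_partial_deriv js \<phi> (x + t *\<^sub>R axis j 1)) has_real_derivative
          iter_partial_deriv (j # js) \<phi> x) (at 0)" for j x
    using assms unfolding C_k_def
    by (simp add: partial_deriv_def DERIV_deriv_iff_field_differentiable)
  show "continuous_on UNIV (iter_partial_deriv (j # js) \<phi>)" for j
    using assms unfolding C_k_def by (metis Suc_le_mono length_Cons)
qed

lemma C_k_mono: "C_k l \<phi> \<Longrightarrow> k \<le> l \<Longrightarrow> C_k k \<phi>"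
  unfolding C_k_def by (meson less_le_trans order_trans)

lemma lists_Suc_eq_image:
  "{js::'a list. length js = Suc k} = (\<lambda>(j, js). j # js) ` (UNIV \<times> {js. length js = k})"
  by (auto simp: length_Suc_conv image_iff)

text \<open>Splitting off the head of the multi-index exhibits the contraction of order \<open>k + 1\<close> as the derivative
in the direction \<open>v\<close> of the contraction of order \<open>k\<close>. The head is also the derivative applied last,
so mixed partial derivatives never have to be interchanged.\<close>

lemma nabla_contract_Suc:
  fixes \<phi> :: "real ^ 'n \<Rightarrow> real"
  shows "nabla_contract (Suc k) \<phi> x v =
    (\<Sum>js | length js = k. (\<Prod>i<k. v $ (js ! i)) *
      (\<Sum>j\<in>UNIV. v $ j * iter_partial_deriv (j # js) \<phi> x))"
proof -
  have inj: "inj_on (\<lambda>(j, js). j # js) (UNIV \<times> {js::'n list. length js = k})"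
    by (auto simp: inj_on_def)
  have "nabla_contract (Suc k) \<phi> x v =
    (\<Sum>(j, js)\<in>UNIV \<times> {js. length js = k}.
      (\<Prod>i<Suc k. v $ ((j # js) ! i)) * iter_partial_deriv (j # js) \<phi> x)"
    unfolding nabla_contract_def lists_Suc_eq_image sum.reindex[OF inj]
    by (simp add: case_prod_unfold comp_def)
  also have "\<dots> = (\<Sum>(j, js)\<in>UNIV \<times> {js. length js = k}.
      (\<Prod>i<k. v $ (js ! i)) * (v $ j * iter_partial_deriv (j # js) \<phi> x))"
    by (intro sum.cong refl) (simp add: prod.lessThan_Suc_shift case_prod_unfold mult_ac
        del: iter_partial_deriv.simps prod.lessThan_Suc)
  also have "\<dots> = (\<Sum>j\<in>UNIV. \<Sum>js | length js = k.
      (\<Prod>i<k. v $ (js ! i)) * (v $ j * iter_partial_deriv (j # js) \<phi> x))"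
    by (simp add: sum.cartesian_product)
  also have "\<dots> = (\<Sum>js | length js = k. \<Sum>j\<in>UNIV.
      (\<Prod>i<k. v $ (js ! i)) * (v $ j * iter_partial_deriv (j # js) \<phi> x))"
    by (rule sum.swap)
  finally show ?thesis by (simp add: sum_distrib_left)
qed

lemma nabla_contract_scale:
  "nabla_contract k \<phi> x (t *\<^sub>R v) = t ^ k * nabla_contract k \<phi> x v"
  by (simp add: nabla_contract_def prod.distrib sum_distrib_left mult_ac)

lemma DERIV_nabla_contract_line:
  fixes \<phi> :: "real ^ 'n \<Rightarrow> real"
  assumes "C_k (Suc k) \<phi>"
  shows "((\<lambda>t. nabla_contract k \<phi> (x0 + t *\<^sub>R v) v) has_real_derivative
           nabla_contract (Suc k) \<phi> (x0 + t *\<^sub>R v) v) (at t)"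
proof -
  have "((\<lambda>t. iter_partial_deriv js \<phi> (x0 + t *\<^sub>R v)) has_real_derivative
          (\<Sum>j\<in>UNIV. v $ j * iter_partial_deriv (j # js) \<phi> (x0 + t *\<^sub>R v))) (at t)"
    if "length js = k" for js
  proof -
    have "((\<lambda>t. iter_partial_deriv js \<phi> (x0 + t *\<^sub>R v)) has_derivative
       (\<lambda>h. \<Sum>j\<in>UNIV. (h *\<^sub>R v) $ j * iter_partial_deriv (j # js) \<phi> (x0 + t *\<^sub>R v))) (at t)"
      by (rule has_derivative_compose[OF _ has_derivative_iter_partial_deriv[OF assms]])
         (use that in \<open>auto intro!: derivative_eq_intros\<close>)
    then show ?thesis
      unfolding has_field_derivative_def
      by (rule has_derivative_eq_rhs)
         (simp add: sum_distrib_left mult_ac fun_eq_iff del: iter_partial_deriv.simps)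
  qed
  then show ?thesis
    unfolding nabla_contract_Suc unfolding nabla_contract_def
    by (intro DERIV_sum DERIV_cmult) auto
qed

lemma differentiable_nabla_contract:
  fixes \<phi> :: "real ^ 'n \<Rightarrow> real" and A :: "real ^ 'm ^ 'n"
  assumes "C_k (Suc k) \<phi>"
  shows "(\<lambda>u. nabla_contract k \<phi> (x0 + A *v u) (A *v u)) differentiable (at s)"
proof -
  have aff: "((\<lambda>u. x0 + A *v u) has_derivative (\<lambda>u. A *v u)) (at s)"
    by (auto intro!: derivative_eq_intros bounded_linear_imp_has_derivative matrix_vector_mul_bounded_linear)
  have "(\<lambda>u. (A *v u) $ j) differentiable (at s)" for j
    by (rule differentiableI bounded_linear.has_derivative[OF bounded_linear_vec_nth]
         bounded_linear_imp_has_derivative[OF matrix_vector_mul_bounded_linear])+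
  then have prod: "(\<lambda>u. \<Prod>i<k. (A *v u) $ (js ! i)) differentiable (at s)" for js
    by (induction k) (auto intro: differentiable_mult)
  have "(\<lambda>u. iter_partial_deriv js \<phi> (x0 + A *v u)) differentiable (at s)"
    if "length js = k" for js
    using that
    by (intro differentiableI[OF has_derivative_compose[OF aff has_derivative_iter_partial_deriv[OF assms]]]) simp
  then show ?thesis unfolding nabla_contract_def
    using prod finite_lists_length_eq[OF finite_class.finite_UNIV, of k]
    by (intro differentiable_sum ballI differentiable_mult) auto
qed

text \<open>Write \<open>g u\<close> for the contraction at \<open>x\<^sub>0 + A u\<close>. The product rule gives
\<open>CARD('m) * g s\<close> plus the derivative of \<open>g\<close> at \<open>s\<close> in the radial direction \<open>s\<close>. As a function of
\<open>t\<close>, \<open>g (t s)\<close> is \<open>t\<^sup>k\<close> times the contraction at \<open>x\<^sub>0 + t A s\<close> with the fixed vector \<open>A s\<close>; hence the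
radial derivative is \<open>k * g s\<close>, from the homogeneous factor, plus the contraction of order \<open>k + 1\<close>.\<close>

lemma divergence_nabla_contract:
  fixes \<phi> :: "real ^ 'n \<Rightarrow> real" and A :: "real ^ 'm ^ 'n"
  assumes "C_k (Suc k) \<phi>"
  shows "divergence (\<lambda>u. nabla_contract k \<phi> (x0 + A *v u) (A *v u) *\<^sub>R u) s =
    (k + CARD('m)) * nabla_contract k \<phi> (x0 + A *v s) (A *v s)
      + nabla_contract (Suc k) \<phi> (x0 + A *v s) (A *v s)"
proof -
  define g where "g u = nabla_contract k \<phi> (x0 + A *v u) (A *v u)" for u
  obtain g' where g': "(g has_derivative g') (at s)"
    using differentiable_nabla_contract[OF assms, of x0 A s]
    unfolding g_def differentiable_def by blast
  interpret g': bounded_linear g' by (rule has_derivative_bounded_linear[OF g'])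
  have dir: "((\<lambda>t. g (s + t *\<^sub>R v)) has_real_derivative g' v) (at 0)" for v
  proof -
    have "((\<lambda>t. g (s + t *\<^sub>R v)) has_derivative (\<lambda>h. g' (h *\<^sub>R v))) (at 0)"
      by (rule has_derivative_compose[where f = "\<lambda>t. s + t *\<^sub>R v" and g = g])
         (use g' in \<open>auto intro!: derivative_eq_intros\<close>)
    then show ?thesis
      unfolding has_field_derivative_def
      by (rule has_derivative_eq_rhs) (simp add: g'.scaleR fun_eq_iff)
  qed
  have "partial_deriv j (\<lambda>u. (g u *\<^sub>R u) $ j) s = g s + s $ j * g' (axis j 1)" for j
    unfolding partial_deriv_def
    by (rule DERIV_imp_deriv) (auto intro!: derivative_eq_intros dir)
  then have "divergence (\<lambda>u. g u *\<^sub>R u) s = CARD('m) * g s + (\<Sum>j\<in>UNIV. s $ j * g' (axis j 1))"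
    by (simp add: divergence_def sum.distrib)
  also have "(\<Sum>j\<in>UNIV. s $ j * g' (axis j 1)) = g' s"
    using arg_cong[OF basis_expansion[of s], of g'] 
    by (simp add: g'.sum g'.scaleR scalar_mult_eq_scaleR)
  also have "g' s = k * g s + nabla_contract (Suc k) \<phi> (x0 + A *v s) (A *v s)"
  proof (rule DERIV_unique[OF dir])
    have ray: "g (s + t *\<^sub>R s) = (1 + t) ^ k * nabla_contract k \<phi> (x0 + (1 + t) *\<^sub>R (A *v s)) (A *v s)" for t
      using nabla_contract_scale[of k \<phi> "x0 + (1 + t) *\<^sub>R (A *v s)" "1 + t" "A *v s"]
      by (simp add: g_def matrix_vector_mult_scaleR scaleR_add_left matrix_vector_right_distrib)
    have "((\<lambda>t. nabla_contract k \<phi> (x0 + (1 + t) *\<^sub>R (A *v s)) (A *v s)) has_real_derivative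
        nabla_contract (Suc k) \<phi> (x0 + A *v s) (A *v s)) (at 0)"
      using DERIV_nabla_contract_line[OF assms, of x0 "A *v s" 1]
        DERIV_shift[of "\<lambda>t. nabla_contract k \<phi> (x0 + t *\<^sub>R (A *v s)) (A *v s)" _ 0 1]
      by (simp add: add.commute)
    then show "((\<lambda>t. g (s + t *\<^sub>R s)) has_real_derivative
        k * g s + nabla_contract (Suc k) \<phi> (x0 + A *v s) (A *v s)) (at 0)"
      unfolding ray by (auto intro!: derivative_eq_intros simp: g_def)
  qed
  finally show ?thesis by (simp add: g_def algebra_simps)
qed

section \<open>Taylor series of smooth functions on the line\<close>

text \<open>A smooth function is carried as the whole family of its derivatives, so that \<open>D k\<close> is the \<open>k\<close>-th
derivative of \<open>D 0\<close>.\<close>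

definition derivative_chain :: "(nat \<Rightarrow> real \<Rightarrow> real) \<Rightarrow> real set \<Rightarrow> bool" where
  "derivative_chain D S \<longleftrightarrow> (\<forall>x\<in>S. \<forall>k. (D k has_real_derivative D (Suc k) x) (at x))"

text \<open>Cauchy's estimates, uniform on \<open>S\<close>: on a compact interval they characterise real analyticity up to
the end points.\<close>

definition analytic_bounds :: "(nat \<Rightarrow> real \<Rightarrow> real) \<Rightarrow> real set \<Rightarrow> bool" where
  "analytic_bounds D S \<longleftrightarrow> (\<exists>M. \<exists>r>0. \<forall>x\<in>S. \<forall>k. \<bar>D k x\<bar> \<le> M * fact k / r ^ k)"

text \<open>The Taylor series of \<open>D 0\<close> about \<open>c\<close>, differentiated \<open>k\<close> times term by term.\<close>

definition taylor_chain :: "(nat \<Rightarrow> real \<Rightarrow> real) \<Rightarrow> real \<Rightarrow> nat \<Rightarrow> real \<Rightarrow> real" where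
  "taylor_chain D c k x = (\<Sum>n. D (n + k) c / fact n * (x - c) ^ n)"

lemma taylor_chain_center: "taylor_chain D c k c = D k c"
  using powser_zero[of "\<lambda>n. D (n + k) c / fact n"] by (simp add: taylor_chain_def)

lemma isCont_derivative_chain: "derivative_chain D S \<Longrightarrow> x \<in> S \<Longrightarrow> isCont (D k) x"
  unfolding derivative_chain_def using DERIV_isCont by blast

lemma derivative_chain_subset: "derivative_chain D S \<Longrightarrow> T \<subseteq> S \<Longrightarrow> derivative_chain D T"
  by (auto simp: derivative_chain_def)

lemma derivative_chain_diff:
  "derivative_chain D S \<Longrightarrow> derivative_chain E S \<Longrightarrow> derivative_chain (\<lambda>k x. D k x - E k x) S"
  by (auto simp: derivative_chain_def intro!: DERIV_diff)

lemma analytic_bounds_subset: "analytic_bounds D S \<Longrightarrow> T \<subseteq> S \<Longrightarrow> analytic_bounds D T"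
  unfolding analytic_bounds_def by blast

lemma factorial_bound_weaken:
  fixes r r' :: real
  assumes "a \<le> M * fact k / r ^ k" "M \<le> M'" "0 \<le> M'" "0 < r'" "r' \<le> r"
  shows "a \<le> M' * fact k / r' ^ k"
proof -
  have "M * fact k / r ^ k \<le> M' * fact k / r' ^ k"
    using assms by (intro frac_le mult_mono power_mono) auto
  then show ?thesis using assms(1) by linarith
qed

lemma analytic_bounds_Un:
  assumes "analytic_bounds D S" "analytic_bounds D T"
  shows "analytic_bounds D (S \<union> T)"
proof -
  obtain M r where "r > 0" and S: "\<forall>x\<in>S. \<forall>k. \<bar>D k x\<bar> \<le> M * fact k / r ^ k"
    using assms(1) by (auto simp: analytic_bounds_def)
  obtain M' r' where "r' > 0" and T: "\<forall>x\<in>T. \<forall>k. \<bar>D k x\<bar> \<le> M' * fact k / r' ^ k"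
    using assms(2) by (auto simp: analytic_bounds_def)
  have "\<bar>D k x\<bar> \<le> max 0 (max M M') * fact k / (min r r') ^ k" if "x \<in> S \<union> T" for x k
    using that S T \<open>r > 0\<close> \<open>r' > 0\<close>
    by (auto intro: factorial_bound_weaken[where M = M and r = r] factorial_bound_weaken[where M = M' and r = r'])
  then show ?thesis using \<open>r > 0\<close> \<open>r' > 0\<close>
    unfolding analytic_bounds_def by (metis min_less_iff_conj)
qed

lemma analytic_bounds_diff:
  assumes "analytic_bounds D S" "analytic_bounds E S"
  shows "analytic_bounds (\<lambda>k x. D k x - E k x) S"
proof -
  obtain M r where "r > 0" and D: "\<forall>x\<in>S. \<forall>k. \<bar>D k x\<bar> \<le> M * fact k / r ^ k"
    using assms(1) by (auto simp: analytic_bounds_def)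
  obtain M' r' where "r' > 0" and E: "\<forall>x\<in>S. \<forall>k. \<bar>E k x\<bar> \<le> M' * fact k / r' ^ k"
    using assms(2) by (auto simp: analytic_bounds_def)
  have "\<bar>D k x - E k x\<bar> \<le> (max 0 M + max 0 M') * fact k / (min r r') ^ k" if "x \<in> S" for x k
  proof -
    have "\<bar>D k x\<bar> \<le> max 0 M * fact k / (min r r') ^ k"
      using D that \<open>r > 0\<close> \<open>r' > 0\<close> by (auto intro: factorial_bound_weaken[where M = M and r = r])
    moreover have "\<bar>E k x\<bar> \<le> max 0 M' * fact k / (min r r') ^ k"
      using E that \<open>r > 0\<close> \<open>r' > 0\<close> by (auto intro: factorial_bound_weaken[where M = M' and r = r'])
    ultimately show ?thesis
      using abs_triangle_ineq4[of "D k x" "E k x"] by (simp add: distrib_right add_divide_distrib)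
  qed
  then show ?thesis using \<open>r > 0\<close> \<open>r' > 0\<close>
    unfolding analytic_bounds_def by (metis min_less_iff_conj)
qed

text \<open>The binomial coefficient is tamed by the fact that \<open>((n + k) choose k) p\<^sup>k q\<^sup>n\<close> is one term of the
expansion of \<open>(p + q) ^ (n + k)\<close>. Choosing \<open>q\<close> close to 1 costs as little of the radius of convergence as
desired.\<close>

lemma fact_add_le:
  fixes p q :: real
  assumes "p > 0" "q > 0" "p + q = 1"
  shows "fact (n + k) \<le> fact n * fact k / (p ^ k * q ^ n)"
proof -
  have "real ((n + k) choose k) * p ^ k * q ^ (n + k - k)
      \<le> (\<Sum>i\<le>n + k. real ((n + k) choose i) * p ^ i * q ^ (n + k - i))"
    using assms by (intro member_le_sum) auto
  also have "\<dots> = 1" using binomial_ring[of p q "n + k"] assms by simp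
  finally have "real ((n + k) choose k) * (p ^ k * q ^ n) \<le> 1" by (simp add: mult_ac)
  moreover have "real ((n + k) choose k) = fact (n + k) / (fact k * fact n)"
    by (simp add: binomial_fact)
  ultimately have "fact (n + k) / (fact k * fact n) * (p ^ k * q ^ n) \<le> 1" by simp
  then show ?thesis using assms by (simp add: field_simps)
qed

lemma taylor_term_bound:
  fixes p q r :: real
  assumes D: "\<And>j. \<bar>D j c\<bar> \<le> M * fact j / r ^ j" and "r > 0" "p > 0" "q > 0" "p + q = 1"
    and x: "\<bar>x - c\<bar> \<le> \<rho>"
  shows "\<bar>D (n + k) c / fact n * (x - c) ^ n\<bar> \<le> M * fact k / (r * p) ^ k * (\<rho> / (r * q)) ^ n"
proof -
  have M: "M \<ge> 0" using D[of 0] by simp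
  have "\<bar>D (n + k) c / fact n * (x - c) ^ n\<bar> = \<bar>D (n + k) c\<bar> / fact n * \<bar>x - c\<bar> ^ n"
    by (simp add: abs_mult power_abs)
  also have "\<dots> \<le> (M * fact (n + k) / r ^ (n + k)) / fact n * \<rho> ^ n"
    using x D[of "n + k"] M \<open>r > 0\<close> by (intro mult_mono divide_right_mono power_mono) auto
  also have "\<dots> \<le> (M * (fact n * fact k / (p ^ k * q ^ n)) / r ^ (n + k)) / fact n * \<rho> ^ n"
    using fact_add_le[OF assms(3-5), of n k] M \<open>r > 0\<close> x
    by (intro mult_right_mono divide_right_mono mult_left_mono zero_le_power) auto
  also have "\<dots> = M * fact k / (r * p) ^ k * (\<rho> / (r * q)) ^ n"
    by (simp add: power_add power_mult_distrib power_divide)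
  finally show ?thesis .
qed

lemma split_unit_weight:
  fixes \<rho> r :: real
  assumes "0 \<le> \<rho>" "\<rho> < r"
  obtains p q where "p > 0" "q > 0" "p + q = 1" "\<rho> < r * q"
proof
  show "(1 - \<rho> / r) / 2 > 0" "(1 + \<rho> / r) / 2 > 0" "(1 - \<rho> / r) / 2 + (1 + \<rho> / r) / 2 = 1"
    using assms by (auto simp: field_simps)
  show "\<rho> < r * ((1 + \<rho> / r) / 2)" using assms by (simp add: field_simps)
qed

context
  fixes D :: "nat \<Rightarrow> real \<Rightarrow> real" and c M r :: real
  assumes D: "\<And>j. \<bar>D j c\<bar> \<le> M * fact j / r ^ j" and r: "r > 0"
begin

lemma summable_taylor:
  assumes "\<bar>x - c\<bar> < r"
  shows "summable (\<lambda>n. D (n + k) c / fact n * (x - c) ^ n)"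
proof -
  obtain p q where pq: "p > 0" "q > 0" "p + q = 1" "\<bar>x - c\<bar> < r * q"
    using split_unit_weight[of "\<bar>x - c\<bar>" r] assms by auto
  show ?thesis
  proof (rule summable_comparison_test')
    show "summable (\<lambda>n. M * fact k / (r * p) ^ k * (\<bar>x - c\<bar> / (r * q)) ^ n)"
      using pq r by (intro summable_mult summable_geometric) (auto simp: abs_mult)
    show "norm (D (n + k) c / fact n * (x - c) ^ n) \<le> M * fact k / (r * p) ^ k * (\<bar>x - c\<bar> / (r * q)) ^ n"
      if "n \<ge> 0" for n
      using taylor_term_bound[where D = D and c = c and x = x and \<rho> = "\<bar>x - c\<bar>", OF D r pq(1-3)]
      by simp
  qed
qed

lemma taylor_chain_bound:
  assumes pq: "p > 0" "q > 0" "p + q = 1" and x: "\<bar>x - c\<bar> \<le> \<rho>" "\<rho> < r * q"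
  shows "\<bar>taylor_chain D c k x\<bar> \<le> M / (1 - \<rho> / (r * q)) * fact k / (r * p) ^ k"
proof -
  have "0 < r * q" using pq r by simp
  then have quot: "0 \<le> \<rho> / (r * q)" "\<rho> / (r * q) < 1"
    using x by (auto simp: field_simps)
  let ?B = "\<lambda>n. M * fact k / (r * p) ^ k * (\<rho> / (r * q)) ^ n"
  have geo: "?B sums (M * fact k / (r * p) ^ k * (1 / (1 - \<rho> / (r * q))))"
    using quot by (intro sums_mult geometric_sums) simp
  have "norm (taylor_chain D c k x) \<le> suminf ?B"
    unfolding taylor_chain_def
  proof (rule norm_suminf_le)
    show "summable ?B" using geo by (rule sums_summable)
    show "norm (D (n + k) c / fact n * (x - c) ^ n) \<le> ?B n" for n
      using taylor_term_bound[where D = D and c = c and x = x, OF D r pq x(1)] by simp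
  qed
  also have "suminf ?B = M / (1 - \<rho> / (r * q)) * fact k / (r * p) ^ k"
    using sums_unique[OF geo] by (simp add: field_simps)
  finally show ?thesis by simp
qed

lemma analytic_bounds_taylor_chain:
  assumes "\<rho> < r"
  shows "analytic_bounds (taylor_chain D c) {c - \<rho>..c + \<rho>}"
proof (cases "\<rho> \<ge> 0")
  case True
  then obtain p q where pq: "p > 0" "q > 0" "p + q = 1" "\<rho> < r * q"
    using split_unit_weight[of \<rho> r] assms by auto
  have "\<forall>x\<in>{c - \<rho>..c + \<rho>}. \<forall>k. \<bar>taylor_chain D c k x\<bar> \<le> M / (1 - \<rho> / (r * q)) * fact k / (r * p) ^ k"
    by (intro ballI allI taylor_chain_bound pq) auto
  moreover have "r * p > 0" using r pq by simp
  ultimately show ?thesis unfolding analytic_bounds_def by blast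
qed (auto simp: analytic_bounds_def intro: exI[of _ 1])

lemma derivative_chain_taylor:
  assumes "\<rho> < r"
  shows "derivative_chain (taylor_chain D c) {c - \<rho>..c + \<rho>}"
  unfolding derivative_chain_def
proof (intro ballI allI)
  fix x k assume "x \<in> {c - \<rho>..c + \<rho>}"
  then have x: "\<bar>x - c\<bar> < r" using assms by auto
  define K where "K = (\<bar>x - c\<bar> + r) / 2"
  have K: "\<bar>x - c\<bar> < K" "K < r" "K > 0" using x by (auto simp: K_def)
  let ?a = "\<lambda>n. D (n + k) c / fact n"
  have "diffs ?a n = D (n + Suc k) c / fact n" for n
    by (simp add: diffs_def field_simps del: of_nat_Suc)
  moreover have "((\<lambda>y. \<Sum>n. ?a n * y ^ n) has_real_derivative (\<Sum>n. diffs ?a n * (x - c) ^ n)) (at (x - c))"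
    by (rule termdiffs_strong[where K = K])
       (use summable_taylor[of "c + K" k] K in auto)
  ultimately have "((\<lambda>y. \<Sum>n. ?a n * y ^ n) has_real_derivative taylor_chain D c (Suc k) x) (at (x + - c))"
    by (simp add: taylor_chain_def)
  then show "(taylor_chain D c k has_real_derivative taylor_chain D c (Suc k) x) (at x)"
    unfolding DERIV_shift by (simp add: taylor_chain_def[abs_def])
qed

end

section \<open>The identity theorem\<close>

text \<open>Near a point of infinite order of vanishing, the Taylor polynomials are all zero and the analytic bounds
drive the Lagrange remainder to zero.\<close>

lemma chain_vanishes_near:
  assumes chain: "derivative_chain E {a..b}"
    and bound: "\<And>x k. x \<in> {a..b} \<Longrightarrow> \<bar>E k x\<bar> \<le> M * fact k / r ^ k" and "r > 0"
    and y: "y \<in> {a..b}" "\<And>k. E k y = 0"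
    and x: "x \<in> {a..b}" "\<bar>x - y\<bar> \<le> r / 4"
  shows "E k x = 0"
proof (cases "x = y")
  case False
  have M: "M \<ge> 0" using bound[OF y(1), of 0] by simp
  have "\<bar>E k x\<bar> \<le> M * fact k / (r / 2) ^ k * (1 / 2) ^ n" if "n > 0" for n
  proof -
    have "\<exists>t. (if x < y then x < t \<and> t < y else y < t \<and> t < x) \<and>
       E k x = (\<Sum>m<n. E (m + k) y / fact m * (x - y) ^ m) + E (n + k) t / fact n * (x - y) ^ n"
      by (rule Taylor[where diff = "\<lambda>m. E (m + k)" and a = a and b = b])
         (use that chain x y False in \<open>auto simp: derivative_chain_def\<close>)
    then obtain t where "if x < y then x < t \<and> t < y else y < t \<and> t < x"
      and eq: "E k x = E (n + k) t / fact n * (x - y) ^ n"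
      using y(2) by auto
    then have t: "t \<in> {a..b}" using x(1) y(1) by (auto split: if_splits)
    have "\<bar>E k x\<bar> = \<bar>E (n + k) t\<bar> / fact n * \<bar>x - y\<bar> ^ n"
      unfolding eq by (simp add: abs_mult power_abs)
    also have "\<dots> \<le> (M * fact (n + k) / r ^ (n + k)) / fact n * (r / 4) ^ n"
      using bound[OF t] M \<open>r > 0\<close> x(2) by (intro mult_mono divide_right_mono power_mono) auto
    also have "\<dots> \<le> (M * (fact n * fact k / ((1 / 2) ^ k * (1 / 2) ^ n)) / r ^ (n + k)) / fact n * (r / 4) ^ n"
      using fact_add_le[of "1/2" "1/2" n k] M \<open>r > 0\<close>
      by (intro mult_right_mono divide_right_mono mult_left_mono zero_le_power) auto
    also have "\<dots> = M * fact k / (r / 2) ^ k * (1 / 2) ^ n"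
    proof -
      have "(4::real) ^ n = 2 ^ n * 2 ^ n" by (simp flip: power_mult_distrib)
      then show ?thesis using \<open>r > 0\<close> by (simp add: power_add power_divide)
    qed
    finally show ?thesis .
  qed
  then have "\<forall>\<^sub>F n in sequentially. \<bar>E k x\<bar> \<le> M * fact k / (r / 2) ^ k * (1 / 2) ^ n"
    using eventually_gt_at_top[of 0] by (rule eventually_mono[rotated])
  moreover have "(\<lambda>n. M * fact k / (r / 2) ^ k * (1 / 2) ^ n) \<longlonglongrightarrow> M * fact k / (r / 2) ^ k * 0"
    by (intro tendsto_mult tendsto_const LIMSEQ_realpow_zero) auto
  ultimately have "\<bar>E k x\<bar> \<le> M * fact k / (r / 2) ^ k * 0"
    by (intro tendsto_lowerbound) auto
  then show ?thesis by simp
qed (use y in simp)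

text \<open>The identity theorem. Every point of the interval is reached from \<open>x0\<close> by finitely many steps of
length at most \<open>r / 4\<close>, the range of the local statement.\<close>

lemma chain_vanishes:
  assumes chain: "derivative_chain E {a..b}" and "analytic_bounds E {a..b}"
    and x0: "x0 \<in> {a..b}" "\<And>k. E k x0 = 0" and x: "x \<in> {a..b}"
  shows "E k x = 0"
proof -
  obtain M r where r: "r > 0" and bound: "\<And>x k. x \<in> {a..b} \<Longrightarrow> \<bar>E k x\<bar> \<le> M * fact k / r ^ k"
    using assms(2) unfolding analytic_bounds_def by metis
  have "\<forall>k. E k x = 0" if "x \<in> {a..b}" "\<bar>x - x0\<bar> \<le> n * (r / 4)" for n :: nat and x
    using that
  proof (induction n arbitrary: x)
    case 0
    then show ?case using x0 by simp
  next
    case (Suc n)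
    \<comment> \<open>The point at fraction \<open>n / (n + 1)\<close> of the way is one step short of \<open>x\<close>.\<close>
    define y where "y = x0 + (x - x0) * (n / Suc n)"
    have frac: "0 \<le> real n / Suc n" "real n / Suc n \<le> 1" "1 - real n / Suc n = 1 / Suc n"
      by (auto simp: field_simps)
    have "y = (1 - n / Suc n) *\<^sub>R x0 + (n / Suc n) *\<^sub>R x"
      by (simp add: y_def left_diff_distrib right_diff_distrib diff_divide_distrib
          mult.commute del: of_nat_Suc)
    then have y: "y \<in> {a..b}"
      using convexD_alt[of "{a..b}" x0 x "n / Suc n"] x0(1) Suc.prems(1) frac by simp
    have "\<bar>y - x0\<bar> = \<bar>x - x0\<bar> * (n / Suc n)" by (simp add: y_def abs_mult)
    also have "\<dots> \<le> (Suc n * (r / 4)) * (n / Suc n)"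
      by (intro mult_right_mono Suc.prems) auto
    finally have "\<bar>y - x0\<bar> \<le> n * (r / 4)" by (simp add: mult.commute del: of_nat_Suc)
    then have zero: "\<forall>k. E k y = 0" by (rule Suc.IH[OF y])
    have near: "\<bar>x - y\<bar> \<le> r / 4"
    proof -
      have "x - y = (x - x0) * (1 - n / Suc n)" by (simp add: y_def algebra_simps)
      then have "\<bar>x - y\<bar> = \<bar>x - x0\<bar> / Suc n" unfolding frac by (simp add: abs_mult)
      also have "\<dots> \<le> (Suc n * (r / 4)) / Suc n"
        using Suc.prems(2) by (rule divide_right_mono) simp
      finally show ?thesis by (simp del: of_nat_Suc)
    qed
    show ?case
      using zero by (intro allI chain_vanishes_near[OF chain bound r y _ Suc.prems(1) near]) auto
  qed
  moreover obtain n :: nat where "\<bar>x - x0\<bar> / (r / 4) \<le> n" using real_arch_simple by blast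
  then have "\<bar>x - x0\<bar> \<le> n * (r / 4)" using r by (simp add: field_simps)
  ultimately show ?thesis using x by blast
qed

lemma chains_agree:
  assumes "derivative_chain D {a..b}" "analytic_bounds D {a..b}"
    "derivative_chain E {a..b}" "analytic_bounds E {a..b}"
    "x0 \<in> {a..b}" "\<And>k. D k x0 = E k x0" "x \<in> {a..b}"
  shows "D k x = E k x"
  using chain_vanishes[OF derivative_chain_diff[OF assms(1,3)] analytic_bounds_diff[OF assms(2,4)]
      assms(5) _ assms(7), of k] assms(6) by simp

lemma analytic_bounds_interval:
  assumes "\<And>x. x \<in> {a..b} \<Longrightarrow> \<exists>e>0. analytic_bounds D ({a..b} \<inter> ball x e)"
  shows "analytic_bounds D {a..b}"
proof (cases "a \<le> b")
  case True
  then have "analytic_bounds D ({a..b} \<inter> {a..b})"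
  proof (induction rule: Bolzano[where P = "\<lambda>u v. analytic_bounds D ({a..b} \<inter> {u..v})"])
    case (trans u v w)
    then have "analytic_bounds D (({a..b} \<inter> {u..v}) \<union> ({a..b} \<inter> {v..w}))"
      by (intro analytic_bounds_Un)
    then show ?case by (rule analytic_bounds_subset) auto
  next
    case (local x)
    then obtain e where "e > 0" "analytic_bounds D ({a..b} \<inter> ball x e)" using assms by auto
    then show ?case
      by (intro exI[of _ e]) (auto elim!: analytic_bounds_subset simp: dist_real_def)
  qed
  then show ?thesis by simp
qed (auto simp: analytic_bounds_def intro: exI[of _ 1])


section \<open>The theorem of Pringsheim and Boas\<close>

text \<open>This and the next lemma concern a gap between \<open>\<alpha>\<close>, where analyticity may fail, and \<open>y\<close>: every
other point of the segment is locally analytic. The Taylor series about \<open>y\<close> represents the function on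
the gap by the identity theorem; since it converges beyond \<open>\<alpha>\<close>, continuity of all the
derivatives carries the agreement to \<open>\<alpha>\<close> itself.\<close>

lemma taylor_chain_at_gap_end:
  assumes chain: "derivative_chain D {a..b}"
    and ab: "\<alpha> \<in> {a..b}" "y \<in> {a..b}" "\<alpha> \<noteq> y"
    and good: "\<And>x. x \<in> closed_segment \<alpha> y - {\<alpha>} \<Longrightarrow> \<exists>e>0. analytic_bounds D ({a..b} \<inter> ball x e)"
    and y: "\<And>k. \<bar>D k y\<bar> \<le> M * fact k / r ^ k" and r: "r > 0" "\<bar>\<alpha> - y\<bar> < r"
  shows "D k \<alpha> = taylor_chain D y k \<alpha>"
proof -
  define \<rho> where "\<rho> = \<bar>\<alpha> - y\<bar>"
  note T = derivative_chain_taylor[of D y, OF y r(1) r(2)[folded \<rho>_def]]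
    analytic_bounds_taylor_chain[of D y, OF y r(1) r(2)[folded \<rho>_def]]
  have agree: "D k z = taylor_chain D y k z" if z: "z \<in> closed_segment \<alpha> y - {\<alpha>}" for z
  proof -
    define I where "I = {min z y..max z y}"
    have I: "I = closed_segment z y"
      by (auto simp: I_def closed_segment_eq_real_ivl)
    have sub: "I \<subseteq> closed_segment \<alpha> y - {\<alpha>}" "I \<subseteq> {a..b}" "I \<subseteq> {y - \<rho>..y + \<rho>}"
      using z ab by (auto simp: I_def \<rho>_def closed_segment_eq_real_ivl split: if_splits)
    have bounds: "analytic_bounds D {min z y..max z y}"
    proof (rule analytic_bounds_interval)
      fix x assume x: "x \<in> {min z y..max z y}"
      then obtain e where e: "e > 0" "analytic_bounds D ({a..b} \<inter> ball x e)"
        using good[of x] sub(1) unfolding I_def by blast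
      have "{min z y..max z y} \<inter> ball x e \<subseteq> {a..b} \<inter> ball x e"
        using sub(2) by (auto simp: I_def)
      then show "\<exists>e>0. analytic_bounds D ({min z y..max z y} \<inter> ball x e)"
        using e analytic_bounds_subset by blast
    qed
    show ?thesis
    proof (rule chains_agree[OF _ bounds])
      show "derivative_chain D {min z y..max z y}"
        using chain sub(2) unfolding I_def by (rule derivative_chain_subset)
      show "derivative_chain (taylor_chain D y) {min z y..max z y}"
        using T(1) sub(3) unfolding I_def by (rule derivative_chain_subset)
      show "analytic_bounds (taylor_chain D y) {min z y..max z y}"
        using T(2) sub(3) unfolding I_def by (rule analytic_bounds_subset)
      show "D j y = taylor_chain D y j y" for j by (simp only: taylor_chain_center)
    qed auto
  qed
  define z where "z n = \<alpha> + (y - \<alpha>) * inverse (real (Suc n))" for n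
  have "z \<longlonglongrightarrow> \<alpha> + (y - \<alpha>) * 0"
    unfolding z_def by (intro tendsto_intros LIMSEQ_inverse_real_of_nat)
  then have lim: "z \<longlonglongrightarrow> \<alpha>" by simp
  have z: "z n \<in> closed_segment \<alpha> y - {\<alpha>}" for n
  proof -
    have "z n = (1 - inverse (real (Suc n))) *\<^sub>R \<alpha> + inverse (real (Suc n)) *\<^sub>R y"
      by (simp add: z_def algebra_simps del: of_nat_Suc)
    moreover have "0 \<le> inverse (real (Suc n))" "inverse (real (Suc n)) \<le> 1"
      by (auto simp: field_simps)
    ultimately have "z n \<in> closed_segment \<alpha> y"
      unfolding in_segment by (intro exI[of _ "inverse (real (Suc n))"] conjI)
    moreover have "z n - \<alpha> \<noteq> 0"
      using ab(3) by (simp add: z_def del: of_nat_Suc)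
    ultimately show ?thesis by simp
  qed
  have cont: "isCont (D k) \<alpha>"
    using isCont_derivative_chain[OF chain ab(1)] .
  have cont': "isCont (taylor_chain D y k) \<alpha>"
    by (rule isCont_derivative_chain[OF T(1)]) (auto simp: \<rho>_def)
  have "(\<lambda>n. D k (z n)) = (\<lambda>n. taylor_chain D y k (z n))"
    using agree[OF z] by auto
  then have "(\<lambda>n. D k (z n)) \<longlonglongrightarrow> taylor_chain D y k \<alpha>"
    using isCont_tendsto_compose[OF cont' lim] by (simp only:)
  then show ?thesis by (rule LIMSEQ_unique[OF isCont_tendsto_compose[OF cont lim]])
qed

text \<open>The Taylor series about \<open>y\<close> and about \<open>\<alpha>\<close> have the same derivatives at \<open>\<alpha>\<close>, hence
coincide. So the derivatives at \<open>y\<close> are controlled by those at \<open>\<alpha>\<close>, whatever \<open>M\<close> is.\<close>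

lemma taylor_chain_across_gap:
  assumes chain: "derivative_chain D {a..b}"
    and ab: "\<alpha> \<in> {a..b}" "y \<in> {a..b}" "\<alpha> \<noteq> y"
    and good: "\<And>x. x \<in> closed_segment \<alpha> y - {\<alpha>} \<Longrightarrow> \<exists>e>0. analytic_bounds D ({a..b} \<inter> ball x e)"
    and y: "\<And>k. \<bar>D k y\<bar> \<le> M * fact k / r ^ k"
    and \<alpha>: "\<And>k. \<bar>D k \<alpha>\<bar> \<le> M' * fact k / r ^ k" and r: "r > 0" "\<bar>\<alpha> - y\<bar> < r"
  shows "D k y = taylor_chain D \<alpha> k y"
proof -
  define \<rho> where "\<rho> = \<bar>\<alpha> - y\<bar>"
  note r' = r(2)[folded \<rho>_def]
  define u v where "u = min \<alpha> y" and "v = max \<alpha> y"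
  have sub: "{u..v} \<subseteq> {\<alpha> - \<rho>..\<alpha> + \<rho>}" "{u..v} \<subseteq> {y - \<rho>..y + \<rho>}"
    by (auto simp: \<rho>_def u_def v_def)
  have chains: "derivative_chain (taylor_chain D \<alpha>) {u..v}" "derivative_chain (taylor_chain D y) {u..v}"
    using derivative_chain_taylor[of D \<alpha>, OF \<alpha> r(1) r'] derivative_chain_taylor[of D y, OF y r(1) r']
      sub by (auto intro: derivative_chain_subset)
  have bounds: "analytic_bounds (taylor_chain D \<alpha>) {u..v}" "analytic_bounds (taylor_chain D y) {u..v}"
    using analytic_bounds_taylor_chain[of D \<alpha>, OF \<alpha> r(1) r']
      analytic_bounds_taylor_chain[of D y, OF y r(1) r']
      sub by (auto intro: analytic_bounds_subset)
  have center: "taylor_chain D \<alpha> j \<alpha> = taylor_chain D y j \<alpha>" for j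
    using taylor_chain_at_gap_end[OF chain ab good y r, of j] by (simp only: taylor_chain_center)
  have "\<alpha> \<in> {u..v}" "y \<in> {u..v}" by (auto simp: u_def v_def)
  then have "taylor_chain D \<alpha> k y = taylor_chain D y k y"
    by (rule chains_agree[OF chains(1) bounds(1) chains(2) bounds(2) _ center])
  then show ?thesis by (simp only: taylor_chain_center)
qed

lemma closed_pointwise_bound:
  assumes "derivative_chain D {a..b}" "closed E" "E \<subseteq> {a..b}"
  shows "closed {x \<in> E. \<forall>k. \<bar>D k x\<bar> \<le> B k}"
proof -
  have "continuous_on E (\<lambda>x. \<bar>D k x\<bar>)" for k
    using assms(3)
    by (intro continuous_on_rabs continuous_at_imp_continuous_on ballI
        isCont_derivative_chain[OF assms(1)]) auto
  then have "closed (\<Inter>k. E \<inter> (\<lambda>x. \<bar>D k x\<bar>) -` {..B k})"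
    using assms(2) by (intro closed_INT ballI continuous_closed_preimage) auto
  moreover have "(\<Inter>k. E \<inter> (\<lambda>x. \<bar>D k x\<bar>) -` {..B k}) = {x \<in> E. \<forall>k. \<bar>D k x\<bar> \<le> B k}" by auto
  ultimately show ?thesis by simp
qed

text \<open>If no \<open>F n\<close> contained a relatively open part of \<open>E\<close>, the sets \<open>E - F n\<close> would be open and dense in
\<open>E\<close> with empty intersection.\<close>

lemma Baire_union:
  fixes E :: "real set" and F :: "nat \<Rightarrow> real set"
  assumes "closed E" "E \<noteq> {}" "\<And>n. closed (F n)" "E \<subseteq> (\<Union>n. F n)"
  shows "\<exists>n. \<exists>x\<in>E. \<exists>e>0. E \<inter> ball x e \<subseteq> F n"
proof (rule ccontr)
  assume none: "\<not> (\<exists>n. \<exists>x\<in>E. \<exists>e>0. E \<inter> ball x e \<subseteq> F n)"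
  have "E \<subseteq> closure (\<Inter>(range (\<lambda>n. E - F n)))"
  proof (rule Baire[OF assms(1)])
    fix T assume "T \<in> range (\<lambda>n. E - F n)"
    then obtain n where T: "T = E - F n" by blast
    have "openin (top_of_set E) (E \<inter> - F n)"
      using assms(3)[of n] by (intro openin_open_Int) auto
    moreover have "x \<in> closure T" if "x \<in> E" for x
      unfolding closure_approachable
    proof (intro allI impI)
      fix e :: real assume "e > 0"
      then have "\<not> E \<inter> ball x e \<subseteq> F n" using none that \<open>x \<in> E\<close> by blast
      then show "\<exists>y\<in>T. dist y x < e" by (auto simp: T dist_commute)
    qed
    ultimately show "openin (top_of_set E) T \<and> E \<subseteq> closure T"
      by (auto simp: T Diff_eq)
  qed auto
  moreover have "\<Inter>(range (\<lambda>n. E - F n)) = {}" using assms(4) by blast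
  ultimately show False using assms(2) by (metis closure_empty subset_empty)
qed

text \<open>Suppose that the closed set \<open>E\<close> of points without a locally uniform bound is nonempty. The constant
\<open>M\<close> in the hypothesis depends on the point, but by Baire's theorem one constant serves on a whole portion of \<open>E\<close>.
A point \<open>y\<close> near this portion is separated from its nearest point \<open>\<alpha>\<close> of \<open>E\<close> by a gap, so its
derivatives are those of the Taylor series about \<open>\<alpha>\<close>, bounded in terms of the common constant.
Thus the bound is locally uniform at a point of \<open>E\<close>, a contradiction.\<close>

theorem Pringsheim_Boas:
  assumes chain: "derivative_chain D {a..b}" and r: "r > 0"
    and pt: "\<And>x. x \<in> {a..b} \<Longrightarrow> \<exists>M. \<forall>k. \<bar>D k x\<bar> \<le> M * fact k / r ^ k"
  shows "analytic_bounds D {a..b}"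
proof (rule analytic_bounds_interval, rule ccontr)
  let ?good = "\<lambda>x. \<exists>e>0. analytic_bounds D ({a..b} \<inter> ball x e)"
  fix x assume x: "x \<in> {a..b}" "\<not> ?good x"
  define E where "E = {x \<in> {a..b}. \<not> ?good x}"
  have "open {x. ?good x}"
    unfolding open_contains_ball
  proof (intro ballI)
    fix x assume "x \<in> {x. ?good x}"
    then obtain e where e: "e > 0" "analytic_bounds D ({a..b} \<inter> ball x e)" by auto
    have "?good y" if y: "y \<in> ball x e" for y
    proof -
      obtain d where "d > 0" "ball y d \<subseteq> ball x e"
        using y open_contains_ball_eq[OF open_ball, of y x e] by metis
      then have "analytic_bounds D ({a..b} \<inter> ball y d)"
        by (intro analytic_bounds_subset[OF e(2)] Int_mono order_refl)
      with \<open>d > 0\<close> show ?thesis by (intro exI[of _ d] conjI)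
    qed
    then have "ball x e \<subseteq> {x. ?good x}" by (intro subsetI CollectI)
    with e(1) show "\<exists>e>0. ball x e \<subseteq> {x. ?good x}" by (intro exI[of _ e] conjI)
  qed
  moreover have "E = {a..b} - {x. ?good x}" by (auto simp: E_def)
  ultimately have E: "closed E" "E \<subseteq> {a..b}" "E \<noteq> {}"
    using x by (auto simp: E_def intro: closed_Diff)
  define F where "F n = {x \<in> E. \<forall>k. \<bar>D k x\<bar> \<le> real n * fact k / r ^ k}" for n
  have "E \<subseteq> (\<Union>n. F n)"
  proof
    fix x assume "x \<in> E"
    then obtain M where M: "\<And>k. \<bar>D k x\<bar> \<le> M * fact k / r ^ k" using pt E(2) by blast
    obtain n :: nat where "M \<le> n" using real_arch_simple by blast
    then have "x \<in> F n"
      using M r \<open>x \<in> E\<close> by (auto simp: F_def intro: factorial_bound_weaken[where M = M and r = r])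
    then show "x \<in> (\<Union>n. F n)" by blast
  qed
  then obtain n x0 e0 where x0: "x0 \<in> E" "e0 > 0" "E \<inter> ball x0 e0 \<subseteq> F n"
    using Baire_union[OF E(1,3), of F] closed_pointwise_bound[OF chain E(1,2)] by (auto simp: F_def)
  \<comment> \<open>The factor 2 keeps the point of \<open>E\<close> nearest to \<open>y\<close> inside the ball of radius \<open>e0\<close>; \<open>r / 4\<close>
      is half of the radius \<open>r / 2\<close> that remains for \<open>p = q = 1/2\<close> in the bound for Taylor series.\<close>
  define e where "e = min (e0 / 2) (r / 4)"
  have e: "e > 0" "e \<le> r / 4" "2 * e \<le> e0" using x0(2) r by (auto simp: e_def)
  have "\<bar>D k y\<bar> \<le> (2 * real n) * fact k / (r / 2) ^ k" if y: "y \<in> {a..b}" "dist y x0 < e" for y k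
  proof -
    obtain \<alpha> where \<alpha>: "\<alpha> \<in> E" "\<And>x. x \<in> E \<Longrightarrow> dist y \<alpha> \<le> dist y x"
      using distance_attains_inf[OF E(1,3), of y] by blast
    have near: "dist y \<alpha> < e" using \<alpha>(2)[OF x0(1)] y(2) by simp
    then have "dist x0 \<alpha> < e0"
      using dist_triangle[of x0 \<alpha> y] y(2) e(3) by (simp add: dist_commute)
    then have \<alpha>_bound: "\<bar>D k \<alpha>\<bar> \<le> real n * fact k / r ^ k" for k
      using x0(3) \<alpha>(1) by (auto simp: F_def)
    have \<alpha>y: "\<bar>y - \<alpha>\<bar> \<le> r / 4" using near e(2) by (simp add: dist_real_def)
    have "D k y = taylor_chain D \<alpha> k y"
    proof (cases "\<alpha> = y")
      case True
      then show ?thesis using taylor_chain_center[of D \<alpha> k] by simp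
    next
      case False
      obtain M where M: "\<And>k. \<bar>D k y\<bar> \<le> M * fact k / r ^ k" using pt y(1) by blast
      show ?thesis
      proof (rule taylor_chain_across_gap[OF chain _ y(1) False _ M \<alpha>_bound r])
        show "\<alpha> \<in> {a..b}" using \<alpha>(1) E(2) by blast
        show "\<bar>\<alpha> - y\<bar> < r" using \<alpha>y r by linarith
        fix x assume x: "x \<in> closed_segment \<alpha> y - {\<alpha>}"
        then have "dist y x < dist y \<alpha>"
          by (auto simp: closed_segment_eq_real_ivl dist_real_def split: if_splits)
        then have "x \<notin> E" using \<alpha>(2) by force
        moreover have "x \<in> {a..b}"
          using x y(1) \<alpha>(1) E(2) by (auto simp: closed_segment_eq_real_ivl split: if_splits)
        ultimately show "?good x" by (simp add: E_def)
      qed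
    qed
    also have "\<bar>\<dots>\<bar> \<le> n / (1 - (r / 4) / (r * (1 / 2))) * fact k / (r * (1 / 2)) ^ k"
      using r by (intro taylor_chain_bound[of D \<alpha>, OF \<alpha>_bound r _ _ _ \<alpha>y]) auto
    finally show ?thesis using r by (simp add: mult_ac)
  qed
  then have "\<forall>y\<in>{a..b} \<inter> ball x0 e. \<forall>k. \<bar>D k y\<bar> \<le> (2 * real n) * fact k / (r / 2) ^ k"
    by (simp add: dist_commute)
  moreover have "r / 2 > 0" using r by simp
  ultimately have "analytic_bounds D ({a..b} \<inter> ball x0 e)"
    unfolding analytic_bounds_def by (intro exI[of _ "2 * real n"] exI[of _ "r / 2"] conjI)
  then show False using x0(1) e(1) by (auto simp: E_def)
qed

section \<open>The limit of the scaled derivatives\<close>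

text \<open>A bound for the power series bounds its partial sums, first for \<open>u < 1\<close> because the tail is nonnegative,
then at \<open>u = 1\<close> by continuity; but the partial sums of the coefficients grow linearly.\<close>

lemma eventually_positive_coefficients_unbounded:
  fixes c :: "nat \<Rightarrow> real"
  assumes \<delta>: "\<delta> > 0" "\<And>n. n \<ge> n0 \<Longrightarrow> c n \<ge> \<delta>"
    and sums: "\<And>u. 0 < u \<Longrightarrow> u < 1 \<Longrightarrow> (\<lambda>n. c n * u ^ n) sums f u"
    and bound: "\<And>u. 0 < u \<Longrightarrow> u < 1 \<Longrightarrow> f u \<le> B"
  shows False
proof -
  have partial: "(\<Sum>n<K. c n) \<le> B" if "K \<ge> n0" for K
  proof -
    have "((\<lambda>u. \<Sum>n<K. c n * u ^ n) \<longlongrightarrow> (\<Sum>n<K. c n * 1 ^ n)) (at_left 1)"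
      by (intro tendsto_intros)
    moreover have "\<forall>\<^sub>F u in at_left 1. (\<Sum>n<K. c n * u ^ n) \<le> B"
    proof -
      have "(\<Sum>n<K. c n * u ^ n) \<le> B" if "0 < u" "u < 1" for u
      proof -
        have "(\<Sum>n<K. c n * u ^ n) \<le> suminf (\<lambda>n. c n * u ^ n)"
          using \<delta> \<open>K \<ge> n0\<close> that sums[OF that]
          by (intro sum_le_suminf) (auto simp: sums_iff intro!: mult_nonneg_nonneg order_trans[OF less_imp_le[OF \<delta>(1)] \<delta>(2)])
        then show ?thesis using sums[OF that] bound[OF that] by (simp add: sums_iff)
      qed
      then show ?thesis
        by (intro eventually_at_leftI[of 0]) auto
    qed
    ultimately have "(\<Sum>n<K. c n * 1 ^ n) \<le> B"
      by (intro tendsto_upperbound) auto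
    then show ?thesis by simp
  qed
  have grow: "(\<Sum>n<n0 + K. c n) \<ge> (\<Sum>n<n0. c n) + K * \<delta>" for K
  proof (induction K)
    case (Suc K)
    then show ?case using \<delta>(2)[of "n0 + K"] by (simp add: algebra_simps)
  qed simp
  obtain K :: nat where "(B - (\<Sum>n<n0. c n)) / \<delta> < K" using reals_Archimedean2 by blast
  then have "B - (\<Sum>n<n0. c n) < K * \<delta>" using \<delta>(1) by (simp add: field_simps)
  then show False using partial[of "n0 + K"] grow[of K] by simp
qed

text \<open>A convergent sequence is bounded. The polynomial factor \<open>fact (k + N) / fact k\<close> is absorbed by
shrinking the radius from \<open>t\<close> to \<open>q * t\<close>.\<close>

lemma pointwise_bound_of_convergent:
  fixes H :: "nat \<Rightarrow> real \<Rightarrow> real"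
  assumes "convergent (\<lambda>k. (- t) ^ k * H k t / fact (k + N))" "0 < t" and q: "0 < q" "q < 1"
  shows "\<exists>M. \<forall>k. \<bar>H k t\<bar> \<le> M * fact k / (q * t) ^ k"
proof -
  obtain K where K: "\<And>k. norm ((- t) ^ k * H k t / fact (k + N)) \<le> K"
    using convergent_imp_Bseq[OF assms(1)] by (auto simp: Bseq_def)
  have "\<bar>H k t\<bar> \<le> (K * fact N / (1 - q) ^ N) * fact k / (q * t) ^ k" for k
  proof -
    have "\<bar>H k t\<bar> * t ^ k \<le> K * fact (k + N)"
      using K[of k] \<open>0 < t\<close> by (simp add: abs_mult power_abs field_simps)
    also have "\<dots> \<le> K * (fact k * fact N / ((1 - q) ^ N * q ^ k))"
      using q order_trans[OF norm_ge_zero K] by (intro mult_left_mono fact_add_le) auto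
    finally show ?thesis using q \<open>0 < t\<close> by (simp add: field_simps power_mult_distrib)
  qed
  then show ?thesis by blast
qed

text \<open>The bounds at the points of \<open>[t, 1]\<close> come with a radius of at least \<open>t / 2\<close>, so the function is analytic
there by the Pringsheim-Boas theorem; at 1 the radius can be taken larger than \<open>1 - t\<close>, so the Taylor series about 1
reaches \<open>t\<close>, and it represents the function by the identity theorem.\<close>

lemma expansion_sums:
  assumes chain: "derivative_chain H {0..1}"
    and conv: "\<And>t. t \<in> {0..1} \<Longrightarrow> convergent (\<lambda>k. (- t) ^ k * H k t / fact (k + N))"
    and t: "0 < t" "t < 1"
  shows "(\<lambda>n. H n 1 / fact n * (t - 1) ^ n) sums H 0 t"
proof -
  have bounds: "analytic_bounds H {t..1}"
  proof (rule Pringsheim_Boas)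
    show "derivative_chain H {t..1}" using chain t by (auto intro: derivative_chain_subset)
    show "1 / 2 * t > 0" using t by simp
    fix x assume x: "x \<in> {t..1}"
    then obtain M where M: "\<And>k. \<bar>H k x\<bar> \<le> M * fact k / (1 / 2 * x) ^ k"
      using pointwise_bound_of_convergent[of x H N "1 / 2"] conv[of x] t by auto
    have "M \<ge> 0" using M[of 0] by simp
    have "\<bar>H k x\<bar> \<le> M * fact k / (1 / 2 * t) ^ k" for k
      by (rule factorial_bound_weaken[OF M]) (use \<open>M \<ge> 0\<close> x t in auto)
    then show "\<exists>M. \<forall>k. \<bar>H k x\<bar> \<le> M * fact k / (1 / 2 * t) ^ k" by blast
  qed
  have "0 < 1 - t / 2" "1 - t / 2 < 1" using t by auto
  then obtain M where M: "\<And>k. \<bar>H k 1\<bar> \<le> M * fact k / (1 - t / 2) ^ k"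
    using pointwise_bound_of_convergent[of 1 H N "1 - t / 2"] conv[of 1] by auto
  have q: "1 - t / 2 > 0" "1 - t < 1 - t / 2" "\<bar>t - 1\<bar> < 1 - t / 2" using t by auto
  have sub: "{t..1} \<subseteq> {1 - (1 - t)..1 + (1 - t)}" using t by auto
  have "H 0 t = taylor_chain H 1 0 t"
  proof (rule chains_agree[OF _ bounds])
    show "derivative_chain H {t..1}" using chain t by (auto intro: derivative_chain_subset)
    show "derivative_chain (taylor_chain H 1) {t..1}"
      using derivative_chain_taylor[of H 1, OF M q(1,2)] sub by (rule derivative_chain_subset)
    show "analytic_bounds (taylor_chain H 1) {t..1}"
      using analytic_bounds_taylor_chain[of H 1, OF M q(1,2)] sub by (rule analytic_bounds_subset)
    show "H k 1 = taylor_chain H 1 k 1" for k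
      using taylor_chain_center[of H 1 k] by simp
  qed (use t in auto)
  then show ?thesis
    using summable_taylor[of H 1, OF M q(1,3), of 0]
    by (simp add: taylor_chain_def summable_sums)
qed

text \<open>If \<open>L > 0\<close>, the coefficients of the expansion in powers of \<open>u = 1 - t\<close> would eventually exceed
\<open>L / 2\<close>, which makes \<open>H 0 t\<close> unbounded as \<open>t\<close> decreases to 0. But \<open>H 0\<close> is continuous at 0.\<close>

lemma scaled_derivatives_limit_nonpos:
  assumes chain: "derivative_chain H {0..1}"
    and conv: "\<And>t. t \<in> {0..1} \<Longrightarrow> convergent (\<lambda>k. (- t) ^ k * H k t / fact (k + N))"
    and lim: "(\<lambda>k. (- 1) ^ k * H k 1 / fact (k + N)) \<longlonglongrightarrow> L"
  shows "L \<le> 0"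
proof (rule ccontr)
  assume "\<not> L \<le> 0"
  then have L: "L / 2 > 0" "L / 2 < L" by auto
  obtain n0 where n0: "\<And>n. n \<ge> n0 \<Longrightarrow> L / 2 < (- 1) ^ n * H n 1 / fact (n + N)"
    using order_tendstoD(1)[OF lim L(2)] by (auto simp: eventually_sequentially)
  define c where "c n = (- 1) ^ n * H n 1 / fact n" for n
  have coeff: "c n \<ge> L / 2" if "n \<ge> n0" for n
  proof -
    have "L / 2 < (- 1) ^ n * H n 1 / fact (n + N)" by (rule n0[OF that])
    also have "0 < (- 1) ^ n * H n 1 / fact (n + N)" using L n0[OF that] by linarith
    then have "0 < (- 1) ^ n * H n 1" by (simp add: zero_less_divide_iff)
    then have "(- 1) ^ n * H n 1 / fact (n + N) \<le> c n"
      unfolding c_def by (intro divide_left_mono fact_mono) auto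
    finally show ?thesis by simp
  qed
  have series: "(\<lambda>n. c n * u ^ n) sums H 0 (1 - u)" if "0 < u" "u < 1" for u
  proof -
    have "(- u) ^ n = (- 1) ^ n * u ^ n" for n by (metis mult_minus1 power_mult_distrib)
    then show ?thesis
      using expansion_sums[OF chain conv, of "1 - u"] that by (simp add: c_def mult_ac)
  qed
  obtain B where B: "\<And>t. t \<in> {0..1} \<Longrightarrow> H 0 t \<le> B"
  proof -
    have "continuous_on {0..1} (H 0)"
      by (intro continuous_at_imp_continuous_on ballI isCont_derivative_chain[OF chain])
    then show thesis
      using continuous_attains_sup[of "{0..1::real}" "H 0"] that by fastforce
  qed
  show False
    by (rule eventually_positive_coefficients_unbounded[OF L(1) coeff series]) (auto intro: B)
qed

text \<open>Smoothness at 0 is what excludes other limits: for \<open>H 0 t = 1 / t\<close>, \<open>N = 0\<close> and \<open>t > 0\<close> the sequence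
is the nonzero constant \<open>1 / t\<close>. The two signs are treated by passing to \<open>- H\<close>.\<close>

lemma scaled_derivatives_limit_zero:
  assumes chain: "derivative_chain H {0..1}"
    and conv: "\<And>t. t \<in> {0..1} \<Longrightarrow> convergent (\<lambda>k. (- t) ^ k * H k t / fact (k + N))"
  shows "(\<lambda>k. (- 1) ^ k * H k 1 / fact (k + N)) \<longlonglongrightarrow> 0"
proof -
  obtain L where lim: "(\<lambda>k. (- 1) ^ k * H k 1 / fact (k + N)) \<longlonglongrightarrow> L"
    using conv[of 1] by (auto simp: convergent_def)
  have "L \<le> 0" by (rule scaled_derivatives_limit_nonpos[OF chain conv lim])
  moreover have "- L \<le> 0"
  proof (rule scaled_derivatives_limit_nonpos)
    show "derivative_chain (\<lambda>k t. - H k t) {0..1}"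
      using chain by (auto simp: derivative_chain_def intro!: DERIV_minus)
    show "convergent (\<lambda>k. (- t) ^ k * - H k t / fact (k + N))" if "t \<in> {0..1}" for t
      using conv[OF that] by (simp add: convergent_minus_iff[symmetric])
    show "(\<lambda>k. (- 1) ^ k * - H k 1 / fact (k + N)) \<longlonglongrightarrow> - L"
      using tendsto_minus[OF lim] by simp
  qed
  ultimately show ?thesis using lim by simp
qed

section \<open>The expansion\<close>

lemma nabla_contract_0 [simp]: "nabla_contract 0 \<phi> x v = \<phi> x"
  by (simp add: nabla_contract_def)

text \<open>The sequence \<open>a\<^sub>k(s)\<close>, whose consecutive differences are the terms of the expansion.\<close>

definition scaled_contraction ::
    "real ^ 'm ^ 'n \<Rightarrow> real ^ 'n \<Rightarrow> (real ^ 'n \<Rightarrow> real) \<Rightarrow> real ^ 'm \<Rightarrow> nat \<Rightarrow> real" where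
  "scaled_contraction A x0 \<phi> s k =
     (-1) ^ k * nabla_contract k \<phi> (x0 + A *v s) (A *v s) / fact (k + (CARD('m) - 1))"

lemma scaled_contraction_0:
  fixes A :: "real ^ 'm ^ 'n"
  shows "scaled_contraction A x0 \<phi> s 0 = \<phi> (x0 + A *v s) / fact (CARD('m) - 1)"
  by (simp add: scaled_contraction_def)

lemma scaled_contraction_Suc:
  fixes A :: "real ^ 'm ^ 'n"
  shows "scaled_contraction A x0 \<phi> s (Suc k) =
    (-1) ^ Suc k / fact (k + CARD('m)) * nabla_contract (Suc k) \<phi> (x0 + A *v s) (A *v s)"
proof -
  have "CARD('m) > 0" by simp
  then have "Suc k + (CARD('m) - 1) = k + CARD('m)" by linarith
  then show ?thesis unfolding scaled_contraction_def by simp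
qed

lemma expansion_term_telescopes:
  fixes A :: "real ^ 'm ^ 'n"
  assumes "C_k (Suc k) \<phi>"
  shows "expansion_term A x0 \<phi> s k =
    scaled_contraction A x0 \<phi> s k - scaled_contraction A x0 \<phi> s (Suc k)"
proof -
  have "CARD('m) > 0" by simp
  then have "k + CARD('m) = Suc (k + (CARD('m) - 1))" by linarith
  then have "fact (k + CARD('m)) = real (k + CARD('m)) * fact (k + (CARD('m) - 1))"
    by (metis fact_Suc)
  moreover have "real (k + CARD('m)) > 0"
    by (simp only: of_nat_0_less_iff) simp
  ultimately have "scaled_contraction A x0 \<phi> s k =
      (-1) ^ k / fact (k + CARD('m)) * (real (k + CARD('m)) * nabla_contract k \<phi> (x0 + A *v s) (A *v s))"
    unfolding scaled_contraction_def by (simp del: of_nat_add)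
  moreover have "expansion_term A x0 \<phi> s k = (-1) ^ k / fact (k + CARD('m)) *
      (real (k + CARD('m)) * nabla_contract k \<phi> (x0 + A *v s) (A *v s)
        + nabla_contract (Suc k) \<phi> (x0 + A *v s) (A *v s))"
    unfolding expansion_term_def add_diff_cancel_left' divergence_nabla_contract[OF assms]
    by simp
  ultimately show ?thesis unfolding scaled_contraction_Suc by (simp add: distrib_left)
qed

lemma scaled_contraction_on_ray:
  fixes A :: "real ^ 'm ^ 'n"
  shows "scaled_contraction A x0 \<phi> (t *\<^sub>R s) k =
    (- t) ^ k * nabla_contract k \<phi> (x0 + t *\<^sub>R (A *v s)) (A *v s) / fact (k + (CARD('m) - 1))"
proof -
  have "(- t) ^ k = (- 1) ^ k * t ^ k" by (metis mult_minus1 power_mult_distrib)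
  then show ?thesis
    by (simp add: scaled_contraction_def matrix_vector_mult_scaleR nabla_contract_scale)
qed

text \<open>The partial sums of the expansion at \<open>t s\<close> are \<open>a\<^sub>0(t s) - a\<^sub>n(t s)\<close>, so convergence of the series at every
point of the segment is convergence of the scaled derivatives of \<open>h\<close> at every \<open>t\<close> in \<open>[0, 1]\<close>.\<close>

lemma scaled_contraction_tendsto_0:
  fixes A :: "real ^ 'm ^ 'n"
  assumes smooth: "C_infinity \<phi>"
    and summable: "\<And>u. u \<in> closed_segment 0 s \<Longrightarrow> summable (expansion_term A x0 \<phi> u)"
  shows "scaled_contraction A x0 \<phi> s \<longlonglongrightarrow> 0"
proof -
  define H where "H k t = nabla_contract k \<phi> (x0 + t *\<^sub>R (A *v s)) (A *v s)" for k t
  have "(\<lambda>k. (- 1) ^ k * H k 1 / fact (k + (CARD('m) - 1))) \<longlonglongrightarrow> 0"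
  proof (rule scaled_derivatives_limit_zero)
    show "derivative_chain H {0..1}"
      using smooth unfolding derivative_chain_def H_def C_infinity_def
      by (intro ballI allI DERIV_nabla_contract_line) auto
    fix t :: real assume t: "t \<in> {0..1}"
    let ?a = "scaled_contraction A x0 \<phi> (t *\<^sub>R s)"
    have "t *\<^sub>R s \<in> closed_segment 0 s" using t by (auto simp: in_segment)
    then have "(\<lambda>n. ?a 0 - (\<Sum>k<n. expansion_term A x0 \<phi> (t *\<^sub>R s) k))
        \<longlonglongrightarrow> ?a 0 - suminf (expansion_term A x0 \<phi> (t *\<^sub>R s))"
      using summable by (intro tendsto_diff tendsto_const summable_LIMSEQ) auto
    moreover have "?a 0 - (\<Sum>k<n. expansion_term A x0 \<phi> (t *\<^sub>R s) k) = ?a n" for n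
      using smooth by (simp add: C_infinity_def expansion_term_telescopes sum_lessThan_telescope')
    ultimately have "convergent ?a" by (auto simp: convergent_def)
    then show "convergent (\<lambda>k. (- t) ^ k * H k t / fact (k + (CARD('m) - 1)))"
      unfolding H_def scaled_contraction_on_ray[abs_def] .
  qed
  then show ?thesis unfolding scaled_contraction_def[abs_def] H_def by simp
qed

theorem theorem5p2:
  fixes A :: "real ^ 'm ^ 'n"
    and x0 :: "real ^ 'n"
    and \<Sigma> :: "(real ^ 'n) set"
    and \<Sigma>\<^sub>s :: "(real ^ 'm) set"
    and \<phi> :: "real ^ 'n \<Rightarrow> real"
  assumes "CARD('m) \<le> CARD('n)"
    and "aff_dim \<Sigma> = int CARD('m)"
    and "x0 \<in> \<Sigma>"
    and "columns_form_basis A (direction_space \<Sigma>)"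
    and "\<Sigma> = (\<lambda>s. x0 + A *v s) ` \<Sigma>\<^sub>s"
  shows "(\<forall>l. C_k (l + 1) \<phi> \<longrightarrow>
            (\<forall>s\<in>\<Sigma>\<^sub>s.
               \<phi> (x0 + A *v s) / fact (CARD('m) - 1) =
                 (\<Sum>k=0..l. expansion_term A x0 \<phi> s k) +
                 (-1) ^ (l + 1) / fact (l + CARD('m)) *
                   nabla_contract (l + 1) \<phi> (x0 + A *v s) ((x0 + A *v s) - x0))) \<and>
         (C_infinity \<phi> \<longrightarrow>
            (\<forall>s\<in>\<Sigma>\<^sub>s.
               (\<forall>u\<in>closed_segment 0 s. summable (expansion_term A x0 \<phi> u)) \<longrightarrow>
               \<phi> (x0 + A *v s) / fact (CARD('m) - 1) =
                 (\<Sum>k. expansion_term A x0 \<phi> s k)))"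
proof (intro conjI allI impI ballI)
  fix l s assume "C_k (l + 1) \<phi>"
  then have "expansion_term A x0 \<phi> s k =
      scaled_contraction A x0 \<phi> s k - scaled_contraction A x0 \<phi> s (Suc k)" if "k \<le> l" for k
    using that by (intro expansion_term_telescopes C_k_mono[of "l + 1" \<phi> "Suc k"]) auto
  then have "(\<Sum>k=0..l. expansion_term A x0 \<phi> s k) =
      (\<Sum>k\<le>l. scaled_contraction A x0 \<phi> s k - scaled_contraction A x0 \<phi> s (Suc k))"
    by (intro sum.cong) auto
  also have "\<dots> = scaled_contraction A x0 \<phi> s 0 - scaled_contraction A x0 \<phi> s (Suc l)"
    by (rule sum_telescope)
  finally show "\<phi> (x0 + A *v s) / fact (CARD('m) - 1) =
      (\<Sum>k=0..l. expansion_term A x0 \<phi> s k) +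
      (-1) ^ (l + 1) / fact (l + CARD('m)) *
        nabla_contract (l + 1) \<phi> (x0 + A *v s) ((x0 + A *v s) - x0)"
    unfolding scaled_contraction_0 scaled_contraction_Suc by simp
next
  fix s assume smooth: "C_infinity \<phi>"
    and "\<forall>u\<in>closed_segment 0 s. summable (expansion_term A x0 \<phi> u)"
  then have "scaled_contraction A x0 \<phi> s \<longlonglongrightarrow> 0"
    by (intro scaled_contraction_tendsto_0) auto
  moreover have "expansion_term A x0 \<phi> s =
      (\<lambda>k. scaled_contraction A x0 \<phi> s k - scaled_contraction A x0 \<phi> s (Suc k))"
    using smooth unfolding C_infinity_def by (intro ext expansion_term_telescopes) blast
  ultimately have "expansion_term A x0 \<phi> s sums scaled_contraction A x0 \<phi> s 0"
    using telescope_sums'[of "scaled_contraction A x0 \<phi> s" 0] by simp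
  then show "\<phi> (x0 + A *v s) / fact (CARD('m) - 1) = (\<Sum>k. expansion_term A x0 \<phi> s k)"
    unfolding scaled_contraction_0 by (rule sums_unique)
qed

end
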